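(* Let $\mathcal X$ be a complex separable Hilbert space and let $A,B,C\in\mathcal B(\mathcal X)$. Assume that the row operator $(A\ B)\in\mathcal B(\mathcal X\oplus\mathcal X,\mathcal X)$ is right invertible and that $B$ and $C$ are self-adjoint, i.e. $B=B^*$ and $C=C^*$. With $\mathcal X_1,\mathcal X_2,\mathcal Y_2,\widetilde A_2,B_2$ as defined in the context, define $$C_2:=P_{\mathcal N(P_{\mathcal R(B)^\perp}A)}\,C|_{\mathcal X_1\oplus\mathcal X_2}:\mathcal X_1\oplus\mathcal X_2\to\mathcal N(P_{\mathcal R(B)^\perp}A),$$ $$(-A^* )_2:=-P_{\mathcal N(P_{\mathcal R(B)^\perp}A)}\,A^*|_{\mathcal Y_2}:\mathcal Y_2\to\mathcal N(P_{\mathcal R(B)^\perp}A).$$ Then the Hamiltonian operator $$H=\begin{pmatrix}A&B\\ C&-A^*\end{pmatrix}\in\mathcal B(\mathcal X\oplus\mathcal X)$$ is an isomorphism if and only if (i) the operator $$\left.\left(C_2-(-A^* )_2B_2^{-1}\widetilde A_2\right)\right|_{P_{\mathcal X}(\mathcal N((A\ B)))}:P_{\mathcal X}(\mathcal N((A\ B)))\to\mathcal N(P_{\mathcal R(B)^\perp}A)$$ is one-to-one and surjective. If in this case we have, in addition, that $\mathcal R(B)$ is closed, then $C_2-(-A^* )_2B_2^{-1}\widetilde A_2\in\mathcal B(\mathcal N(P_{\mathcal R(B)^\perp}A))$ is an isomorphism.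
   Context: $\mathcal B(\mathcal X,\mathcal Y)$ denotes the bounded linear operators from $\mathcal X$ to $\mathcal Y$, and $\mathcal B(\mathcal X)=\mathcal B(\mathcal X,\mathcal X)$. $\mathcal R(T)$ and $\mathcal N(T)$ denote range and kernel of $T$. An isomorphism is a linear bijection that is bounded with bounded inverse. $T\in\mathcal B(\mathcal X,\mathcal Y)$ is right invertible if there is $S\in\mathcal B(\mathcal Y,\mathcal X)$ with $TS=I_{\mathcal Y}$. $P_\Omega$ is the orthogonal projection onto a closed subspace $\Omega$; $P_{\mathcal X}$ is the projection of $\mathcal X\oplus\mathcal X$ onto the first component. For closed subspaces $\Omega_1\subset\Omega$, $\Omega\ominus\Omega_1$ is the orthogonal complement of $\Omega_1$ in $\Omega$. The row operator is $(A\ B)\binom{x}{y}=Ax+By$. Define $\mathcal X_1:=\mathcal N(A)$, $\mathcal X_2:=\mathcal N(A)^\perp\ominus\mathcal N(P_{\mathcal R(B)^\perp}A)^\perp$, $\mathcal Y_2:=\mathcal N(B)^\perp\ominus\mathcal N(P_{\mathcal R(A)^\perp}B)^\perp$ (all subspaces of $\mathcal X$). Thus $\mathcal X_1\oplus\mathcal X_2=\mathcal N(P_{\mathcal R(B)^\perp}A)$. Let $A_2:\mathcal X_2\to\overline{\mathcal R(A)}\cap\overline{\mathcal R(B)}$ and $B_2:\mathcal Y_2\to\overline{\mathcal R(A)}\cap\overline{\mathcal R(B)}$ be the restrictions of $A$ to $\mathcal X_2$ and of $B$ to $\mathcal Y_2$ (they do take values in $\overline{\mathcal R(A)}\cap\overline{\mathcal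 R(B)}$), and let $\widetilde A_2:=(0\ A_2):\mathcal X_1\oplus\mathcal X_2\to\overline{\mathcal R(A)}\cap\overline{\mathcal R(B)}$, i.e. $\widetilde A_2$ is the restriction of $A$ to $\mathcal X_1\oplus\mathcal X_2$. $B_2$ is one-to-one and $B_2^{-1}:\mathcal R(B_2)\to\mathcal Y_2$ denotes its inverse on its range. When $(A\ B)$ is right invertible one has $P_{\mathcal X}(\mathcal N((A\ B)))\subset\mathcal X_1\oplus\mathcal X_2$ and $\widetilde A_2$ maps $P_{\mathcal X}(\mathcal N((A\ B)))$ into $\mathcal R(B_2)$, so $B_2^{-1}\widetilde A_2$ is well defined on $P_{\mathcal X}(\mathcal N((A\ B)))$ with values in $\mathcal Y_2$. If moreover $\mathcal R(B)$ is closed, then $P_{\mathcal X}(\mathcal N((A\ B)))=\mathcal N(P_{\mathcal R(B)^\perp}A)$, so $B_2^{-1}\widetilde A_2$ is defined on all of $\mathcal N(P_{\mathcal R(B)^\perp}A)$. *)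

theory Defs
  imports "HOL-Analysis.Analysis"
begin

section \<open>Complex Hilbert spaces\<close>

text \<open>
  The norm, metric and topology are those of the library class \<open>real_inner\<close>; by the axiom
  \<open>inner_eq_Re_cinner\<close> its inner product is the real part of the complex one, so that
  \<open>norm x\<close> is the square root of \<open>cinner x x\<close>. The complex inner product is linear in
  the first argument.
\<close>

class complex_vector = real_vector +
  fixes scaleC :: "complex \<Rightarrow> 'a \<Rightarrow> 'a" (infixr \<open>*\<^sub>C\<close> 75)
  assumes scaleC_add_right: "c *\<^sub>C (x + y) = c *\<^sub>C x + c *\<^sub>C y"
    and scaleC_add_left: "(c + d) *\<^sub>C x = c *\<^sub>C x + d *\<^sub>C x"
    and scaleC_scaleC: "c *\<^sub>C d *\<^sub>C x = (c * d) *\<^sub>C x"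
    and scaleC_one: "1 *\<^sub>C x = x"
    and scaleR_eq_scaleC: "scaleR r x = complex_of_real r *\<^sub>C x"

class complex_inner = complex_vector + real_inner +
  fixes cinner :: "'a \<Rightarrow> 'a \<Rightarrow> complex"
  assumes cinner_commute: "cinner x y = cnj (cinner y x)"
    and cinner_add_left: "cinner (x + y) z = cinner x z + cinner y z"
    and cinner_scaleC_left: "cinner (c *\<^sub>C x) y = c * cinner x y"
    and inner_eq_Re_cinner: "inner x y = Re (cinner x y)"

class chilbert_space = complex_inner + complete_space

instantiation complex :: chilbert_space
begin

definition scaleC_complex :: "complex \<Rightarrow> complex \<Rightarrow> complex"
  where "scaleC_complex c x = c * x"

definition cinner_complex :: "complex \<Rightarrow> complex \<Rightarrow> complex"
  where "cinner_complex x y = x * cnj y"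

instance
  by standard
    (simp_all add: scaleC_complex_def cinner_complex_def inner_complex_def algebra_simps
      scaleR_conv_of_real)

end

instantiation prod :: (complex_vector, complex_vector) complex_vector
begin

definition scaleC_prod :: "complex \<Rightarrow> 'a \<times> 'b \<Rightarrow> 'a \<times> 'b"
  where "scaleC_prod c p = (c *\<^sub>C fst p, c *\<^sub>C snd p)"

instance
  by standard
    (simp_all add: scaleC_prod_def scaleC_add_right scaleC_add_left scaleC_scaleC scaleC_one
      scaleR_eq_scaleC scaleR_prod_def)

end

instantiation prod :: (complex_inner, complex_inner) complex_inner
begin

definition cinner_prod :: "'a \<times> 'b \<Rightarrow> 'a \<times> 'b \<Rightarrow> complex"
  where "cinner_prod p q = cinner (fst p) (fst q) + cinner (snd p) (snd q)"

instance
proof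
  fix p q r :: "'a \<times> 'b" and c :: complex
  show "cinner p q = cnj (cinner q p)"
    unfolding cinner_prod_def complex_cnj_add by (metis cinner_commute)
  show "cinner (p + q) r = cinner p r + cinner q r"
    by (simp add: cinner_prod_def cinner_add_left)
  show "cinner (c *\<^sub>C p) q = c * cinner p q"
    by (simp add: cinner_prod_def scaleC_prod_def cinner_scaleC_left distrib_left)
  show "inner p q = Re (cinner p q)"
    by (simp add: cinner_prod_def inner_prod_def inner_eq_Re_cinner)
qed

end

instance prod :: (chilbert_space, chilbert_space) chilbert_space ..

section \<open>Bounded operators\<close>

definition bounded_clinear_on ::
    "'a::complex_inner set \<Rightarrow> 'b::complex_inner set \<Rightarrow> ('a \<Rightarrow> 'b) \<Rightarrow> bool"
  where "bounded_clinear_on V W T \<longleftrightarrow>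
    T ` V \<subseteq> W \<and>
    (\<forall>x\<in>V. \<forall>y\<in>V. T (x + y) = T x + T y) \<and>
    (\<forall>c. \<forall>x\<in>V. T (c *\<^sub>C x) = c *\<^sub>C T x) \<and>
    (\<exists>K. \<forall>x\<in>V. norm (T x) \<le> K * norm x)"

abbreviation bounded_clinear :: "('a::complex_inner \<Rightarrow> 'b::complex_inner) \<Rightarrow> bool"
  where "bounded_clinear \<equiv> bounded_clinear_on UNIV UNIV"

lemma bounded_clinear_iff:
  "bounded_clinear T \<longleftrightarrow> bounded_linear T \<and> (\<forall>c x. T (c *\<^sub>C x) = c *\<^sub>C T x)"
proof
  assume T: "bounded_clinear T"
  then obtain K where "\<And>x. norm (T x) \<le> K * norm x"
    unfolding bounded_clinear_on_def by blast
  with T show "bounded_linear T \<and> (\<forall>c x. T (c *\<^sub>C x) = c *\<^sub>C T x)"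
    unfolding bounded_clinear_on_def
    by (auto intro!: bounded_linear_intro[where K = K] simp: scaleR_eq_scaleC mult.commute)
next
  assume T: "bounded_linear T \<and> (\<forall>c x. T (c *\<^sub>C x) = c *\<^sub>C T x)"
  then interpret bounded_linear T by simp
  obtain K where "\<And>x. norm (T x) \<le> K * norm x"
    using nonneg_bounded by (metis mult.commute)
  with T show "bounded_clinear T"
    unfolding bounded_clinear_on_def by (auto simp: add)
qed

definition cisomorphism_on ::
    "'a::complex_inner set \<Rightarrow> 'b::complex_inner set \<Rightarrow> ('a \<Rightarrow> 'b) \<Rightarrow> bool"
  where "cisomorphism_on V W T \<longleftrightarrow>
    bounded_clinear_on V W T \<and> bij_betw T V W \<and> bounded_clinear_on W V (inv_into V T)"

definition right_invertible :: "('a::complex_inner \<Rightarrow> 'b::complex_inner) \<Rightarrow> bool"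
  where "right_invertible T \<longleftrightarrow> (\<exists>S. bounded_clinear S \<and> T \<circ> S = id)"

definition ker :: "('a \<Rightarrow> 'b::zero) \<Rightarrow> 'a set"
  where "ker T = {x. T x = 0}"

text \<open>Hilbert space adjoint; it exists and is unique for bounded operators on a Hilbert space.\<close>

definition cadjoint :: "('a::complex_inner \<Rightarrow> 'b::complex_inner) \<Rightarrow> 'b \<Rightarrow> 'a"
  where "cadjoint T = (THE S. \<forall>x y. cinner (T x) y = cinner x (S y))"

section \<open>Orthogonality\<close>

definition corth :: "'a::complex_inner set \<Rightarrow> 'a set"
  where "corth V = {x. \<forall>y\<in>V. cinner x y = 0}"

text \<open>Orthogonal projection; it exists and is unique when \<open>V\<close> is a closed subspace of a
  Hilbert space.\<close>

definition orth_proj :: "'a::complex_inner set \<Rightarrow> 'a \<Rightarrow> 'a"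
  where "orth_proj V x = (THE y. y \<in> V \<and> x - y \<in> corth V)"

definition ominus :: "'a::complex_inner set \<Rightarrow> 'a set \<Rightarrow> 'a set"
  where "ominus V U = V \<inter> corth U"

definition subspace_sum :: "'a::complex_inner set \<Rightarrow> 'a set \<Rightarrow> 'a set"
  where "subspace_sum U V = {u + v |u v. u \<in> U \<and> v \<in> V}"

section \<open>Block operators\<close>

definition row_op :: "('a \<Rightarrow> 'c) \<Rightarrow> ('b \<Rightarrow> 'c) \<Rightarrow> 'a \<times> 'b \<Rightarrow> 'c::plus"
  where "row_op A B = (\<lambda>(x, y). A x + B y)"

definition block_op ::
    "('a \<Rightarrow> 'c) \<Rightarrow> ('b \<Rightarrow> 'c) \<Rightarrow> ('a \<Rightarrow> 'd) \<Rightarrow> ('b \<Rightarrow> 'd) \<Rightarrow> 'a \<times> 'b \<Rightarrow> 'c::plus \<times> 'd::plus"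
  where "block_op A B C D = (\<lambda>p. (row_op A B p, row_op C D p))"

definition hamiltonian ::
    "('a::complex_inner \<Rightarrow> 'a) \<Rightarrow> ('a \<Rightarrow> 'a) \<Rightarrow> ('a \<Rightarrow> 'a) \<Rightarrow> 'a \<times> 'a \<Rightarrow> 'a \<times> 'a"
  where "hamiltonian A B C = block_op A B C (\<lambda>y. - cadjoint A y)"

section \<open>The subspaces and the compressed operators\<close>

definition NPA :: "('a::complex_inner \<Rightarrow> 'a) \<Rightarrow> ('a \<Rightarrow> 'a) \<Rightarrow> 'a set"
  where "NPA A B = ker (orth_proj (corth (range B)) \<circ> A)"

definition X1 :: "('a::complex_inner \<Rightarrow> 'a) \<Rightarrow> 'a set"
  where "X1 A = ker A"

definition X2 :: "('a::complex_inner \<Rightarrow> 'a) \<Rightarrow> ('a \<Rightarrow> 'a) \<Rightarrow> 'a set"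
  where "X2 A B = ominus (corth (ker A)) (corth (NPA A B))"

definition X12 :: "('a::complex_inner \<Rightarrow> 'a) \<Rightarrow> ('a \<Rightarrow> 'a) \<Rightarrow> 'a set"
  where "X12 A B = subspace_sum (X1 A) (X2 A B)"

text \<open>\<open>NPA B A\<close> is the kernel of \<open>B\<close> followed by the projection onto the orthogonal complement
  of the range of \<open>A\<close>.\<close>

definition Y2 :: "('a::complex_inner \<Rightarrow> 'a) \<Rightarrow> ('a \<Rightarrow> 'a) \<Rightarrow> 'a set"
  where "Y2 A B = ominus (corth (ker B)) (corth (NPA B A))"

text \<open>The operators below are only meaningful on the indicated domain; \<open>restrict\<close> makes them
  \<open>undefined\<close> elsewhere.\<close>

text \<open>\<open>A2_tilde\<close> is the row operator \<open>(0 A2)\<close> on the sum of \<open>X1\<close> (where \<open>A\<close> vanishes) and \<open>X2\<close>, with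
  \<open>A2\<close> the restriction of \<open>A\<close> to \<open>X2\<close>.\<close>

definition A2_tilde :: "('a::complex_inner \<Rightarrow> 'a) \<Rightarrow> ('a \<Rightarrow> 'a) \<Rightarrow> 'a \<Rightarrow> 'a"
  where "A2_tilde A B = restrict A (X12 A B)"

definition B2 :: "('a::complex_inner \<Rightarrow> 'a) \<Rightarrow> ('a \<Rightarrow> 'a) \<Rightarrow> 'a \<Rightarrow> 'a"
  where "B2 A B = restrict B (Y2 A B)"

definition B2_inv :: "('a::complex_inner \<Rightarrow> 'a) \<Rightarrow> ('a \<Rightarrow> 'a) \<Rightarrow> 'a \<Rightarrow> 'a"
  where "B2_inv A B = inv_into (Y2 A B) (B2 A B)"

definition C2 :: "('a::complex_inner \<Rightarrow> 'a) \<Rightarrow> ('a \<Rightarrow> 'a) \<Rightarrow> ('a \<Rightarrow> 'a) \<Rightarrow> 'a \<Rightarrow> 'a"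
  where "C2 A B C = restrict (\<lambda>x. orth_proj (NPA A B) (C x)) (X12 A B)"

definition minus_adj_A2 :: "('a::complex_inner \<Rightarrow> 'a) \<Rightarrow> ('a \<Rightarrow> 'a) \<Rightarrow> 'a \<Rightarrow> 'a"
  where "minus_adj_A2 A B = restrict (\<lambda>y. - orth_proj (NPA A B) (cadjoint A y)) (Y2 A B)"

definition schur_op :: "('a::complex_inner \<Rightarrow> 'a) \<Rightarrow> ('a \<Rightarrow> 'a) \<Rightarrow> ('a \<Rightarrow> 'a) \<Rightarrow> 'a \<Rightarrow> 'a"
  where "schur_op A B C = (\<lambda>x. C2 A B C x - minus_adj_A2 A B (B2_inv A B (A2_tilde A B x)))"

end

theory Submission
  imports Defs
begin

text \<open>
  Write \<open>K\<close> for the kernel of the row operator and \<open>N\<close> for \<open>NPA A B\<close>. Since the row operator is onto,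
  \<open>H\<close> is bijective iff \<open>(x, y) \<mapsto> C x - A* y\<close> maps \<open>K\<close> bijectively onto the whole space. Every element
  of \<open>K\<close> has the form \<open>(x, n - B2\<^sup>-\<^sup>1 A2~ x)\<close> with \<open>n \<in> ker B\<close>. As \<open>B\<close> is self-adjoint,
  \<open>ker B\<close> is the orthogonal complement of \<open>range B\<close>; a right inverse of the row operator bounds \<open>A*\<close>
  from below there, so \<open>A*\<close> maps \<open>ker B\<close> bijectively onto a closed subspace, which is the
  orthogonal complement of \<open>N\<close>. Dividing out this part leaves the compression to \<open>N\<close>, which is the
  Schur operator on the first components of \<open>K\<close>. Bijective bounded operators are isomorphisms by the
  open mapping theorem. If \<open>range B\<close> is closed, \<open>B\<close> is bounded below on the complement of its
  kernel, which bounds the Schur operator; its inverse is \<open>z \<mapsto> fst (H\<^sup>-\<^sup>1 (0, z))\<close>.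
\<close>

instance chilbert_space \<subseteq> banach ..

section \<open>Projections, functionals and open maps\<close>

text \<open>By the parallelogram law a minimising sequence for the distance from \<open>x\<close> to
  \<open>V\<close> is Cauchy, since midpoints stay in \<open>V\<close> and cannot beat the infimum
  \<open>D\<close>. Its limit is a nearest point, and moving it along \<open>w\<close> cannot reduce
  the distance, which forces orthogonality. Real scalars suffice here; \<open>corth_eq_inner\<close>
  carries the result over to complex subspaces.\<close>

lemma subspace_orth_decomp:
  fixes V :: "'a::{real_inner,complete_space} set"
  assumes V: "subspace V" "closed V"
  obtains v where "v \<in> V" "\<And>w. w \<in> V \<Longrightarrow> inner (x - v) w = 0"
proof -
  define D where "D = (INF v\<in>V. (norm (x - v))\<^sup>2)"
  have bdd: "bdd_below ((\<lambda>v. (norm (x - v))\<^sup>2) ` V)"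
    by (rule bdd_belowI2[of _ 0]) simp
  have D_le: "D \<le> (norm (x - v))\<^sup>2" if "v \<in> V" for v
    unfolding D_def by (rule cINF_lower[OF bdd that])
  have "\<exists>v\<in>V. (norm (x - v))\<^sup>2 < D + 1 / Suc n" for n
  proof -
    have "D < D + 1 / Suc n" by simp
    then show ?thesis
      unfolding D_def using cINF_less_iff[OF _ bdd] subspace_0[OF V(1)] by (metis empty_iff)
  qed
  then obtain s where s: "\<And>n. s n \<in> V" "\<And>n. (norm (x - s n))\<^sup>2 < D + 1 / Suc n"
    by metis
  have par: "(norm (s m - s n))\<^sup>2 \<le> 2 / Suc m + 2 / Suc n" for m n
  proof -
    have "(1/2) *\<^sub>R (s m + s n) \<in> V"
      using V(1) s(1) by (intro subspace_scale subspace_add)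
    from D_le[OF this] have "D \<le> (norm (x - (1/2) *\<^sub>R (s m + s n)))\<^sup>2" .
    moreover have "(norm (s m - s n))\<^sup>2 = 2 * (norm (x - s m))\<^sup>2 + 2 * (norm (x - s n))\<^sup>2
        - 4 * (norm (x - (1/2) *\<^sub>R (s m + s n)))\<^sup>2"
      unfolding power2_norm_eq_inner
      by (simp add: inner_diff_left inner_diff_right inner_add_left inner_add_right
          inner_commute algebra_simps)
    ultimately show ?thesis using s(2)[of m] s(2)[of n] by simp
  qed
  have "Cauchy s"
  proof (rule metric_CauchyI)
    fix e :: real assume e: "0 < e"
    obtain N where N: "4 / e\<^sup>2 < real N" using reals_Archimedean2 by blast
    have "dist (s m) (s n) < e" if "m \<ge> N" "n \<ge> N" for m n
    proof -
      have "0 < real N" using N e by (meson less_trans divide_pos_pos zero_less_numeral zero_less_power)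
      have "2 / Suc m + 2 / Suc n \<le> 2 / N + 2 / N"
        using that \<open>0 < real N\<close> by (intro add_mono divide_left_mono) auto
      also have "\<dots> < e\<^sup>2" using N e \<open>0 < real N\<close> by (simp add: field_simps)
      finally have "(norm (s m - s n))\<^sup>2 < e\<^sup>2" using par[of m n] by simp
      then show ?thesis using e by (simp add: dist_norm power_less_imp_less_base)
    qed
    then show "\<exists>M. \<forall>m\<ge>M. \<forall>n\<ge>M. dist (s m) (s n) < e" by blast
  qed
  then obtain v where v: "s \<longlonglongrightarrow> v" using Cauchy_convergent convergent_def by blast
  have vV: "v \<in> V" using closed_sequentially[OF V(2) _ v] s(1) by blast
  have "(\<lambda>n. (norm (x - s n))\<^sup>2) \<longlonglongrightarrow> (norm (x - v))\<^sup>2" by (intro tendsto_intros v)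
  moreover have "(\<lambda>n. D + 1 / Suc n) \<longlonglongrightarrow> D + 0"
    using LIMSEQ_inverse_real_of_nat by (intro tendsto_intros) (simp add: inverse_eq_divide)
  ultimately have le: "(norm (x - v))\<^sup>2 \<le> D"
    using LIMSEQ_le less_imp_le[OF s(2)] by fastforce
  have "inner (x - v) w = 0" if w: "w \<in> V" for w
  proof (cases "w = 0")
    case False
    \<comment> \<open>This \<open>t\<close> minimises the distance from \<open>x\<close> to the line
      through \<open>v\<close> in direction \<open>w\<close>.\<close>
    define t where "t = inner (x - v) w / inner w w"
    have "v + t *\<^sub>R w \<in> V" using V(1) vV w by (intro subspace_add subspace_scale)
    then have "(norm (x - v))\<^sup>2 \<le> (norm (x - (v + t *\<^sub>R w)))\<^sup>2" using D_le le order_trans by blast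
    also have "\<dots> = (norm (x - v))\<^sup>2 - 2 * t * inner (x - v) w + t * (t * inner w w)"
      unfolding power2_norm_eq_inner
      by (simp add: inner_diff_left inner_diff_right inner_add_left inner_add_right
          inner_commute algebra_simps)
    also have "t * inner w w = inner (x - v) w" using False by (simp add: t_def)
    finally have "t * inner (x - v) w \<le> 0" by simp
    then have "(inner (x - v) w)\<^sup>2 / inner w w \<le> 0" by (simp add: t_def power2_eq_square)
    then show ?thesis using False
      by (metis divide_pos_pos inner_gt_zero_iff not_le zero_less_power2)
  qed simp
  with vV show ?thesis by (rule that)
qed

text \<open>Removing from some \<open>u\<close> with \<open>f u \<noteq> 0\<close> its projection
  onto the kernel leaves a vector \<open>?e\<close> orthogonal to the kernel. Every \<open>x\<close>
  differs from a multiple of \<open>?e\<close> by a kernel element, so pairing with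
  \<open>?e\<close> determines \<open>f x\<close>. The lemma serves the existence of
  adjoints.\<close>

lemma riesz_representation:
  fixes f :: "'a::{real_inner,complete_space} \<Rightarrow> real"
  assumes "bounded_linear f"
  obtains z where "\<And>x. f x = inner x z"
proof (cases "\<forall>x. f x = 0")
  case True
  then show ?thesis using that[of 0] by simp
next
  case False
  interpret f: bounded_linear f by fact
  from False obtain u where u: "f u \<noteq> 0" by blast
  have "subspace {x. f x = 0}"
    by (auto simp: subspace_def f.add f.scaleR)
  moreover have "closed {x. f x = 0}"
    by (intro closed_Collect_eq continuous_intros f.continuous_on)
  ultimately obtain v where v: "f v = 0" "\<And>w. f w = 0 \<Longrightarrow> inner (u - v) w = 0"
    using subspace_orth_decomp[of "{x. f x = 0}" u] by auto
  let ?e = "u - v"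
  have fe: "f ?e = f u" using v by (simp add: f.diff)
  then have e: "inner ?e ?e \<noteq> 0" using u f.zero by auto
  have "f x = inner x ((f u / inner ?e ?e) *\<^sub>R ?e)" for x
  proof -
    have "f (x - (f x / f u) *\<^sub>R ?e) = 0" using fe u by (simp add: f.diff f.scaleR)
    from v(2)[OF this] have "inner ?e x = (f x / f u) * inner ?e ?e"
      by (simp only: inner_diff_right inner_scaleR_right)
    then show ?thesis using e u by (simp add: inner_commute[of x] del: inner_diff_left)
  qed
  then show ?thesis by (rule that)
qed

text \<open>Solve approximately, then solve again for the error; the corrections form a geometrically
  convergent series.\<close>

lemma bounded_solution_if_approximate:
  fixes T :: "'a::banach \<Rightarrow> 'b::real_normed_vector"
  assumes T: "bounded_linear T"
    and approx: "\<And>y. \<exists>x. norm x \<le> M * norm y \<and> norm (y - T x) \<le> norm y / 2"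
  shows "\<exists>x. T x = y \<and> norm x \<le> 2 * M * norm y"
proof -
  interpret T: bounded_linear T by fact
  obtain g where g: "\<And>y. norm (g y) \<le> M * norm y" "\<And>y. norm (y - T (g y)) \<le> norm y / 2"
    using approx by metis
  \<comment> \<open>\<open>r k\<close> is the error left after \<open>k\<close> corrections, so the
    images of the corrections telescope to \<open>y - r n\<close>.\<close>
  define r where "r k = ((\<lambda>u. u - T (g u)) ^^ k) y" for k
  have r0: "r 0 = y" and rSuc: "\<And>k. r (Suc k) = r k - T (g (r k))" by (simp_all add: r_def)
  have r_le: "norm (r k) \<le> norm y * (1/2) ^ k" for k
  proof (induction k)
    case (Suc k)
    then show ?case using g(2)[of "r k"] by (simp add: rSuc)
  qed (simp add: r0)
  \<comment> \<open>No sign of \<open>M\<close> is assumed: for \<open>y \<noteq> 0\<close> the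
    bound on \<open>g y\<close> forces \<open>M \<ge> 0\<close>, and for \<open>y = 0\<close> all
    errors vanish.\<close>
  have M: "M * norm (r k) \<le> M * norm y * (1/2) ^ k" for k
  proof (cases "y = 0")
    case True
    then show ?thesis using r_le[of k] by simp
  next
    case False
    then have "M \<ge> 0" using g(1)[of y] norm_ge_zero[of "g y"]
      by (meson dual_order.trans norm_le_zero_iff not_le zero_le_mult_iff)
    then show ?thesis using r_le[of k] by (simp add: mult_left_mono mult.assoc)
  qed
  have gr: "norm (g (r k)) \<le> M * norm y * (1/2) ^ k" for k
    using g(1) M order_trans by blast
  have geo: "(\<lambda>k. M * norm y * (1/2) ^ k) sums (2 * M * norm y)"
    using sums_mult[OF geometric_sums[of "1/2::real"], of "M * norm y"] by (simp add: mult_ac)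
  have sm: "summable (\<lambda>k. g (r k))"
    by (rule summable_comparison_test'[OF sums_summable[OF geo], of 0]) (use gr in auto)
  define x where "x = (\<Sum>k. g (r k))"
  have "norm x \<le> 2 * M * norm y"
    unfolding x_def sums_unique[OF geo]
    by (rule norm_suminf_le[OF gr sums_summable[OF geo]])
  moreover have "T x = y"
  proof -
    have "(\<Sum>k<n. T (g (r k))) = y - r n" for n
      by (induction n) (simp_all add: r0 rSuc)
    moreover have "(\<lambda>k. T (g (r k))) sums T x"
      unfolding x_def by (intro T.sums summable_sums sm)
    ultimately have "(\<lambda>n. y - r n) \<longlonglongrightarrow> T x" by (simp add: sums_def)
    moreover have "r \<longlonglongrightarrow> 0"
    proof (rule Lim_null_comparison)
      show "(\<lambda>k. norm y * (1/2) ^ k) \<longlonglongrightarrow> 0"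
        by (intro tendsto_mult_right_zero LIMSEQ_power_zero) simp
    qed (use r_le in simp)
    then have "(\<lambda>n. y - r n) \<longlonglongrightarrow> y - 0" by (intro tendsto_intros)
    ultimately show ?thesis using LIMSEQ_unique by fastforce
  qed
  ultimately show ?thesis by blast
qed

text \<open>By Baire, the closure of the image of some ball has an interior point. Symmetry and
  convexity move this to a ball around 0, so every \<open>y\<close> is approximated up to half its
  norm by the image of a vector of controlled norm. The preceding lemma turns this into exact
  solutions.\<close>

lemma open_mapping_bound:
  fixes T :: "'a::banach \<Rightarrow> 'b::banach"
  assumes T: "bounded_linear T" and "surj T"
  obtains M where "\<And>y. \<exists>x. T x = y \<and> norm x \<le> M * norm y"
proof -
  interpret T: bounded_linear T by fact
  define F where "F n = closure (T ` cball 0 (real n))" for n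
  have "y \<in> (\<Union>n. F n)" for y
  proof -
    obtain x where "T x = y" using \<open>surj T\<close> by (metis surjD)
    moreover obtain n where "norm x \<le> real n" using real_arch_simple by blast
    ultimately show ?thesis unfolding F_def using closure_subset by force
  qed
  then have UN: "(\<Union>n. F n) = UNIV" by blast
  have "\<exists>n. interior (F n) \<noteq> {}"
  proof (rule ccontr)
    assume "\<not> ?thesis"
    then have "euclidean interior_of (\<Union>(range F)) = {}"
      by (intro Baire_category_alt) (auto simp: completely_metrizable_space_euclidean F_def)
    then show False using UN by simp
  qed
  then obtain n y0 where "y0 \<in> interior (F n)" by blast
  then obtain e where e: "e > 0" "cball y0 e \<subseteq> F n"
    by (meson mem_interior_cball)
  have neg: "- z \<in> F n" if "z \<in> F n" for z
  proof -
    have "uminus ` T ` cball 0 (real n) = T ` cball 0 (real n)"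
    proof -
      have "uminus ` T ` cball 0 (real n) = T ` uminus ` cball 0 (real n)"
        by (simp add: image_image T.neg)
      also have "uminus ` cball 0 (real n) = cball (0::'a) (real n)"
        by (auto intro!: image_eqI[of _ _ "- _"])
      finally show ?thesis .
    qed
    then have "uminus ` F n = F n" 
      using closure_scaleR[of "-1" "T ` cball 0 (real n)"] by (simp add: F_def)
    then show ?thesis using that by blast
  qed
  have conv: "convex (F n)"
    unfolding F_def by (intro convex_closure convex_linear_image convex_cball T.linear_axioms)
  have ball: "z \<in> F n" if "norm z \<le> e" for z
  proof -
    \<comment> \<open>\<open>z\<close> is the midpoint of \<open>y0 + z\<close> and
      \<open>- (y0 - z)\<close>, and both lie in \<open>F n\<close>.\<close>
    have "y0 + z \<in> cball y0 e" "y0 - z \<in> cball y0 e"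
      using that by (simp_all add: dist_norm)
    then have "y0 + z \<in> F n" "- (y0 - z) \<in> F n"
      using e(2) by (auto intro: neg simp only:)
    then have "(1/2) *\<^sub>R (y0 + z) + (1/2) *\<^sub>R (- (y0 - z)) \<in> F n"
      using conv by (intro convexD) auto
    moreover have "(1/2) *\<^sub>R (y0 + z) + (1/2) *\<^sub>R (- (y0 - z)) = z"
      by (simp add: algebra_simps flip: scaleR_add_left)
    ultimately show ?thesis by simp
  qed
  have "\<exists>x. norm x \<le> (real n / e) * norm y \<and> norm (y - T x) \<le> norm y / 2" for y
  proof (cases "y = 0")
    case False
    let ?c = "e / norm y"
    have "?c *\<^sub>R y \<in> F n" using False e by (intro ball) simp
    then have "\<exists>z \<in> T ` cball 0 (real n). dist z (?c *\<^sub>R y) < e / 2"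
      unfolding F_def closure_approachable using e(1) half_gt_zero by blast
    then obtain x where x: "norm x \<le> n" "dist (T x) (?c *\<^sub>R y) < e / 2" by auto
    have "y - T (inverse ?c *\<^sub>R x) = inverse ?c *\<^sub>R (?c *\<^sub>R y - T x)"
      using e(1) False by (simp add: T.scaleR algebra_simps)
    then have "norm (y - T (inverse ?c *\<^sub>R x)) = inverse ?c * norm (T x - ?c *\<^sub>R y)"
      using e(1) by (simp add: norm_minus_commute)
    also have "\<dots> \<le> inverse ?c * (e / 2)"
      using x(2) e(1) by (intro mult_left_mono) (auto simp: dist_norm)
    also have "\<dots> = norm y / 2" using e by simp
    finally have "norm (y - T (inverse ?c *\<^sub>R x)) \<le> norm y / 2" .
    moreover have "norm (inverse ?c *\<^sub>R x) \<le> (n / e) * norm y"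
      using x(1) e(1) by (simp add: field_simps mult_right_mono)
    ultimately show ?thesis by blast
  qed (auto intro!: exI[of _ 0] simp: T.zero)
  from bounded_solution_if_approximate[OF T this] show ?thesis by (rule that)
qed

section \<open>Complex Hilbert space geometry\<close>

lemma scaleC_zero_right [simp]: "c *\<^sub>C (0::'a::complex_vector) = 0"
  using scaleC_add_right[of c 0 "0::'a"] by simp

lemma scaleC_minus_right: "c *\<^sub>C (- x) = - (c *\<^sub>C (x::'a::complex_vector))"
  using scaleC_add_right[of c x "- x"] by (simp add: add_eq_0_iff)

lemma cinner_scaleC_right: "cinner x (c *\<^sub>C y) = cnj c * cinner x (y::'a::complex_inner)"
  by (metis cinner_commute cinner_scaleC_left complex_cnj_mult)

lemma cinner_add_right: "cinner x (y + z) = cinner x y + cinner x (z::'a::complex_inner)"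
  by (metis cinner_commute cinner_add_left complex_cnj_add)

text \<open>The imaginary part is the real part after multiplication by \<open>- \<i>\<close>, the
  conjugate of \<open>\<i>\<close>. Complex identities thus reduce to two real ones.\<close>

lemma cinner_eq_Complex_inner:
  "cinner x y = Complex (inner x y) (inner x (\<i> *\<^sub>C (y::'a::complex_inner)))"
  by (simp add: complex_eq_iff inner_eq_Re_cinner cinner_scaleC_right)

lemma cinner_eq_0_iff:
  "cinner x y = 0 \<longleftrightarrow> inner x y = 0 \<and> inner x (\<i> *\<^sub>C (y::'a::complex_inner)) = 0"
  by (simp add: cinner_eq_Complex_inner complex_eq_iff)

lemma inner_scaleC_ii: "inner x (\<i> *\<^sub>C y) = - inner (\<i> *\<^sub>C x) (y::'a::complex_inner)"
  by (simp add: inner_eq_Re_cinner cinner_scaleC_left cinner_scaleC_right)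

lemma cinner_right_unique:
  fixes y z :: "'a::complex_inner"
  assumes "\<And>x. cinner x y = cinner x z"
  shows "y = z"
  using assms by (intro vector_eq_ldot[THEN iffD1]) (simp add: inner_eq_Re_cinner)

text \<open>Closure under \<open>\<i>\<close> is what makes real and complex orthogonality to the
  set coincide.\<close>

definition csubspace :: "'a::complex_vector set \<Rightarrow> bool"
  where "csubspace V \<longleftrightarrow>
    0 \<in> V \<and> (\<forall>x\<in>V. \<forall>y\<in>V. x + y \<in> V) \<and> (\<forall>c. \<forall>x\<in>V. c *\<^sub>C x \<in> V)"

lemma csubspace_imp_subspace: "csubspace V \<Longrightarrow> subspace V"
  by (simp add: csubspace_def subspace_def scaleR_eq_scaleC)

lemma csubspace_0: "csubspace V \<Longrightarrow> 0 \<in> V"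
  and csubspace_add: "csubspace V \<Longrightarrow> x \<in> V \<Longrightarrow> y \<in> V \<Longrightarrow> x + y \<in> V"
  and csubspace_scaleC: "csubspace V \<Longrightarrow> x \<in> V \<Longrightarrow> c *\<^sub>C x \<in> V"
  by (simp_all add: csubspace_def)

lemma csubspace_diff: "csubspace V \<Longrightarrow> x \<in> V \<Longrightarrow> y \<in> V \<Longrightarrow> x - y \<in> V"
  by (rule subspace_diff[OF csubspace_imp_subspace])

lemma csubspace_neg: "csubspace V \<Longrightarrow> x \<in> V \<Longrightarrow> - x \<in> V"
  by (rule subspace_neg[OF csubspace_imp_subspace])

lemma csubspace_UNIV: "csubspace UNIV"
  by (simp add: csubspace_def)

text \<open>The imaginary part of \<open>cinner x y\<close> is
  \<open>inner x (\<i> *\<^sub>C y)\<close>, and \<open>\<i> *\<^sub>C y\<close> is again in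
  \<open>V\<close>.\<close>

lemma corth_eq_inner:
  assumes "csubspace V"
  shows "corth V = {x. \<forall>y\<in>V. inner x y = 0}"
  unfolding corth_def cinner_eq_0_iff using csubspace_scaleC[OF assms] by auto

lemma csubspace_corth: "csubspace (corth (V::'a::complex_inner set))"
proof -
  have "cinner 0 y = 0" for y :: 'a
    by (simp add: cinner_eq_0_iff)
  then show ?thesis
    by (simp add: csubspace_def corth_def cinner_add_left cinner_scaleC_left)
qed

lemma closed_corth: "closed (corth (V::'a::complex_inner set))"
proof -
  have "corth V = (\<Inter>y\<in>V. {x. inner x y = 0} \<inter> {x. inner x (\<i> *\<^sub>C y) = 0})"
    by (auto simp: corth_def cinner_eq_0_iff)
  then show ?thesis
    by (auto intro!: closed_INT closed_Int closed_Collect_eq continuous_intros)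
qed

lemma inner_corth: "x \<in> corth V \<Longrightarrow> y \<in> V \<Longrightarrow> inner x y = 0"
  by (simp add: corth_def inner_eq_Re_cinner)

lemma corth_disjoint: "x \<in> V \<Longrightarrow> x \<in> corth V \<Longrightarrow> x = 0"
  using inner_corth[of x V x] by simp

lemma subset_corth_corth: "V \<subseteq> corth (corth (V::'a::complex_inner set))"
proof -
  have "cinner x y = 0" if "cinner y x = 0" for x y :: 'a
    using that cinner_commute[of x y] by simp
  then show ?thesis by (auto simp: corth_def)
qed

section \<open>Orthogonal projections onto closed complex subspaces\<close>

lemma orth_proj_exists:
  fixes V :: "'a::chilbert_space set"
  assumes V: "csubspace V" "closed V"
  shows "\<exists>y. y \<in> V \<and> x - y \<in> corth V"
proof -
  obtain v where "v \<in> V" "\<And>w. w \<in> V \<Longrightarrow> inner (x - v) w = 0"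
    using subspace_orth_decomp[OF csubspace_imp_subspace[OF V(1)] V(2)] by blast
  then show ?thesis by (auto simp: corth_eq_inner[OF V(1)])
qed

text \<open>Two candidates differ by a vector that lies both in \<open>V\<close> and in its
  complement. This evaluates the definite description; the properties of \<open>orth_proj\<close>
  below rest on it.\<close>

lemma orth_proj_eqI:
  fixes V :: "'a::complex_inner set"
  assumes V: "csubspace V" and y: "y \<in> V" "x - y \<in> corth V"
  shows "orth_proj V x = y"
  unfolding orth_proj_def
proof (rule the_equality)
  fix z assume z: "z \<in> V \<and> x - z \<in> corth V"
  have "z - y \<in> V" using z y csubspace_diff[OF V] by blast
  moreover have "(x - y) - (x - z) \<in> corth V" using z y csubspace_diff[OF csubspace_corth] by blast
  ultimately show "z = y" using corth_disjoint[of "z - y" V] by simp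
qed (use y in simp)

context
  fixes V :: "'a::chilbert_space set"
  assumes V: "csubspace V" "closed V"
begin

lemma orth_proj_in: "orth_proj V x \<in> V"
  and orth_proj_diff: "x - orth_proj V x \<in> corth V"
  using orth_proj_exists[OF V, of x] orth_proj_eqI[OF V(1)] by metis+

lemma orth_proj_id: "x \<in> V \<Longrightarrow> orth_proj V x = x"
  using csubspace_0[OF csubspace_corth] by (intro orth_proj_eqI[OF V(1)]) auto

lemma orth_proj_eq_0_iff: "orth_proj V x = 0 \<longleftrightarrow> x \<in> corth V"
  using orth_proj_diff[of x] orth_proj_eqI[OF V(1) csubspace_0[OF V(1)], of x] by auto

lemma orth_proj_add: "orth_proj V (x + y) = orth_proj V x + orth_proj V y"
proof (rule orth_proj_eqI[OF V(1)])
  have "(x - orth_proj V x) + (y - orth_proj V y) \<in> corth V"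
    by (intro csubspace_add[OF csubspace_corth] orth_proj_diff)
  then show "x + y - (orth_proj V x + orth_proj V y) \<in> corth V"
    by (simp add: algebra_simps)
qed (intro csubspace_add[OF V(1)] orth_proj_in)

lemma orth_proj_scaleC: "orth_proj V (c *\<^sub>C x) = c *\<^sub>C orth_proj V x"
proof (rule orth_proj_eqI[OF V(1)])
  have "c *\<^sub>C (x - orth_proj V x) \<in> corth V"
    by (intro csubspace_scaleC[OF csubspace_corth] orth_proj_diff)
  then show "c *\<^sub>C x - c *\<^sub>C orth_proj V x \<in> corth V"
    by (simp add: scaleC_add_right scaleC_minus_right flip: add_uminus_conv_diff)
qed (intro csubspace_scaleC[OF V(1)] orth_proj_in)

lemma norm_orth_proj_le: "norm (orth_proj V x) \<le> norm x"
proof -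
  have "(norm x)\<^sup>2 = (norm ((x - orth_proj V x) + orth_proj V x))\<^sup>2" by simp
  also have "\<dots> = (norm (x - orth_proj V x))\<^sup>2 + (norm (orth_proj V x))\<^sup>2"
    using inner_corth[OF orth_proj_diff[of x] orth_proj_in[of x]]
    unfolding power2_norm_eq_inner inner_add_left inner_add_right by (simp add: inner_commute)
  finally have "(norm (orth_proj V x))\<^sup>2 \<le> (norm x)\<^sup>2" by simp
  then show ?thesis by (simp add: power2_le_iff_abs_le)
qed

lemma bounded_clinear_orth_proj: "bounded_clinear (orth_proj V)"
  unfolding bounded_clinear_on_def
  using orth_proj_add orth_proj_scaleC norm_orth_proj_le by (auto intro!: exI[of _ 1])

lemma corth_corth: "corth (corth V) = V"
proof
  show "corth (corth V) \<subseteq> V"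
  proof
    fix x assume x: "x \<in> corth (corth V)"
    have "x - orth_proj V x \<in> corth (corth V)"
      using x orth_proj_in subset_corth_corth by (blast intro: csubspace_diff[OF csubspace_corth])
    then have "x - orth_proj V x = 0" using corth_disjoint orth_proj_diff by blast
    then show "x \<in> V" using orth_proj_in[of x] by simp
  qed
qed (rule subset_corth_corth)

end

section \<open>Bounded complex-linear maps: kernels, images and adjoints\<close>

lemma bounded_clinearD:
  assumes "bounded_clinear T"
  shows "bounded_linear T" "T (c *\<^sub>C x) = c *\<^sub>C T x"
    "T (x + y) = T x + T y" "T (x - y) = T x - T y" "T (- x) = - T x" "T 0 = 0"
  using assms unfolding bounded_clinear_iff
  by (auto simp: linear_add linear_diff linear_neg linear_0 bounded_linear.linear)

lemma csubspace_ker: "bounded_clinear T \<Longrightarrow> csubspace (ker T)"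
  by (simp add: csubspace_def ker_def bounded_clinearD)

lemma closed_ker: "bounded_clinear T \<Longrightarrow> closed (ker T)"
  unfolding ker_def
  by (intro closed_Collect_eq continuous_on_const linear_continuous_on bounded_clinearD)

lemma csubspace_image:
  assumes T: "bounded_clinear T" and V: "csubspace V"
  shows "csubspace (T ` V)"
  unfolding csubspace_def
proof (intro conjI ballI allI)
  show "0 \<in> T ` V"
    using csubspace_0[OF V] bounded_clinearD(6)[OF T] by (metis imageI)
next
  fix x y assume "x \<in> T ` V" "y \<in> T ` V"
  then obtain u v where "x = T u" "y = T v" "u \<in> V" "v \<in> V" by blast
  then have "x + y = T (u + v)" "u + v \<in> V"
    using csubspace_add[OF V] by (simp_all add: bounded_clinearD[OF T])
  then show "x + y \<in> T ` V" by simp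
next
  fix c x assume "x \<in> T ` V"
  then obtain u where "x = T u" "u \<in> V" by blast
  then have "c *\<^sub>C x = T (c *\<^sub>C u)" "c *\<^sub>C u \<in> V"
    using csubspace_scaleC[OF V] by (simp_all add: bounded_clinearD[OF T])
  then show "c *\<^sub>C x \<in> T ` V" by simp
qed

lemma csubspace_vimage:
  "bounded_clinear T \<Longrightarrow> csubspace V \<Longrightarrow> csubspace (T -` V)"
  by (simp add: csubspace_def bounded_clinearD)

lemma closed_vimage_clinear: "bounded_clinear T \<Longrightarrow> closed V \<Longrightarrow> closed (T -` V)"
  by (intro closed_vimage linear_continuous_on bounded_clinearD)

lemma ex_adjoint:
  fixes T :: "'a::chilbert_space \<Rightarrow> 'b::complex_inner"
  assumes T: "bounded_clinear T"
  shows "\<exists>S. \<forall>x y. cinner (T x) y = cinner x (S y)"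
proof -
  have "\<exists>z. \<forall>x. inner (T x) y = inner x z" for y
  proof -
    have "bounded_linear (\<lambda>x. inner (T x) y)"
      by (intro bounded_linear_compose[OF bounded_linear_inner_left] bounded_clinearD(1) T)
    then show ?thesis using riesz_representation by blast
  qed
  then obtain S where S: "\<And>x y. inner (T x) y = inner x (S y)" by metis
  have "cinner (T x) y = cinner x (S y)" for x y
    \<comment> \<open>Riesz yields the adjoint identity for real parts only; applying it to
      \<open>\<i> *\<^sub>C x\<close> as well supplies the imaginary parts.\<close>
    using S[of x y] S[of "\<i> *\<^sub>C x" y]
    by (simp add: cinner_eq_Complex_inner inner_scaleC_ii bounded_clinearD[OF T])
  then show ?thesis by blast
qed

lemma cinner_cadjoint:
  fixes T :: "'a::chilbert_space \<Rightarrow> 'b::complex_inner"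
  assumes "bounded_clinear T"
  shows "cinner (T x) y = cinner x (cadjoint T y)"
proof -
  obtain S where S: "\<forall>x y. cinner (T x) y = cinner x (S y)"
    using ex_adjoint[OF assms] by blast
  then have "cadjoint T = S"
    unfolding cadjoint_def
    by (intro the_equality ext) (auto intro: cinner_right_unique)
  with S show ?thesis by simp
qed

lemma inner_cadjoint:
  fixes T :: "'a::chilbert_space \<Rightarrow> 'b::complex_inner"
  assumes "bounded_clinear T"
  shows "inner (T x) y = inner x (cadjoint T y)"
  by (simp add: inner_eq_Re_cinner cinner_cadjoint[OF assms])

lemma bounded_clinear_cadjoint:
  fixes T :: "'a::chilbert_space \<Rightarrow> 'b::complex_inner"
  assumes T: "bounded_clinear T"
  shows "bounded_clinear (cadjoint T)"
proof -
  note adj = cinner_cadjoint[OF T]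
  have "cadjoint T (x + y) = cadjoint T x + cadjoint T y" for x y
    by (rule cinner_right_unique) (simp add: cinner_add_right flip: adj)
  moreover have "cadjoint T (c *\<^sub>C x) = c *\<^sub>C cadjoint T x" for c x
    by (rule cinner_right_unique) (simp add: cinner_scaleC_right flip: adj)
  moreover obtain K where K: "0 \<le> K" "\<And>x. norm (T x) \<le> norm x * K"
    using bounded_linear.nonneg_bounded[OF bounded_clinearD(1)[OF T]] by blast
  have "norm (cadjoint T y) \<le> K * norm y" for y
  proof (cases "cadjoint T y = 0")
    case True
    then show ?thesis using K(1) by simp
  next
    case False
    let ?z = "cadjoint T y"
    \<comment> \<open>The adjoint identity is tested at the vector \<open>?z\<close> itself, so that
      one factor \<open>norm ?z\<close> cancels at the end.\<close>
    have "norm ?z * norm ?z = inner (T ?z) y"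
      by (simp add: inner_cadjoint[OF T] flip: power2_norm_eq_inner power2_eq_square)
    also have "\<dots> \<le> norm (T ?z) * norm y" by (rule norm_cauchy_schwarz)
    also have "\<dots> \<le> norm ?z * K * norm y" by (intro mult_right_mono K(2)) simp
    finally show ?thesis using False by simp
  qed
  ultimately show ?thesis unfolding bounded_clinear_on_def by blast
qed

section \<open>Operators with a right invertible row\<close>

lemma bounded_clinear_row_op:
  fixes A B :: "'a::complex_inner \<Rightarrow> 'a"
  assumes A: "bounded_clinear A" and B: "bounded_clinear B"
  shows "bounded_clinear (row_op A B)"
proof -
  have "bounded_linear (\<lambda>p. A (fst p) + B (snd p))"
    by (intro bounded_linear_add bounded_linear_compose[OF bounded_clinearD(1)[OF A]]
        bounded_linear_compose[OF bounded_clinearD(1)[OF B]] bounded_linear_fst bounded_linear_snd)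
  then show ?thesis
    by (simp add: bounded_clinear_iff row_op_def case_prod_unfold scaleC_prod_def scaleC_add_right
        bounded_clinearD(2)[OF A] bounded_clinearD(2)[OF B])
qed

lemma bounded_clinear_hamiltonian:
  fixes A B C :: "'a::chilbert_space \<Rightarrow> 'a"
  assumes A: "bounded_clinear A" and B: "bounded_clinear B" and C: "bounded_clinear C"
  shows "bounded_clinear (hamiltonian A B C)"
proof -
  have D: "bounded_clinear (\<lambda>y. - cadjoint A y)"
    using bounded_clinear_cadjoint[OF A]
    by (simp add: bounded_clinear_iff bounded_linear_minus scaleC_minus_right)
  note R = bounded_clinear_row_op[OF A B] bounded_clinear_row_op[OF C D]
  show ?thesis
    unfolding hamiltonian_def block_op_def
    using bounded_linear_Pair[OF bounded_clinearD(1)[OF R(1)] bounded_clinearD(1)[OF R(2)]]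
    by (simp add: bounded_clinear_iff scaleC_prod_def[where 'a='a and 'b='a, of _ "(_, _)"]
        bounded_clinearD(2)[OF R(1)] bounded_clinearD(2)[OF R(2)])
qed

text \<open>Open mapping supplies a preimage of controlled norm, and injectivity identifies it with
  the value of the inverse.\<close>

lemma cisomorphism_on_UNIV_iff:
  fixes T :: "'a::chilbert_space \<Rightarrow> 'b::chilbert_space"
  assumes T: "bounded_clinear T"
  shows "cisomorphism_on UNIV UNIV T \<longleftrightarrow> bij T"
proof
  assume b: "bij T"
  obtain M where M: "\<And>y. \<exists>x. T x = y \<and> norm x \<le> M * norm y"
    using open_mapping_bound[OF bounded_clinearD(1)[OF T]] b by (metis bij_is_surj)
  have inv: "inv T (T x) = x" for x using b by (simp add: bij_is_inj)
  have "inv T (x + y) = inv T x + inv T y" for x y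
    by (rule inv_f_eq[OF bij_is_inj[OF b]])
      (simp add: bounded_clinearD[OF T] surj_f_inv_f[OF bij_is_surj[OF b]])
  moreover have "inv T (c *\<^sub>C x) = c *\<^sub>C inv T x" for c x
    by (rule inv_f_eq[OF bij_is_inj[OF b]])
      (simp add: bounded_clinearD[OF T] surj_f_inv_f[OF bij_is_surj[OF b]])
  moreover have "norm (inv T y) \<le> M * norm y" for y
    using M[of y] inv by auto
  ultimately have "bounded_clinear (inv T)"
    unfolding bounded_clinear_on_def by blast
  with T b show "cisomorphism_on UNIV UNIV T"
    by (simp add: cisomorphism_on_def)
qed (simp add: cisomorphism_on_def)

text \<open>This is where a closed range yields a norm bound; it later controls
  \<open>B2_inv\<close>.\<close>

lemma closed_range_bounded_below:
  fixes B :: "'a::chilbert_space \<Rightarrow> 'a"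
  assumes B: "bounded_clinear B" and ker: "ker B = corth (range B)" and cl: "closed (range B)"
  obtains M where "\<And>y. y \<in> corth (ker B) \<Longrightarrow> norm y \<le> M * norm (B y)"
proof -
  note K = csubspace_ker[OF B] closed_ker[OF B]
  note R = csubspace_image[OF B csubspace_UNIV]
  \<comment> \<open>adding the projection onto the kernel makes \<open>B\<close> onto, so open mapping applies on the whole space\<close>
  define T where "T x = B x + orth_proj (ker B) x" for x
  have T: "bounded_linear T"
    unfolding T_def
    by (intro bounded_linear_add bounded_clinearD(1) B bounded_clinear_orth_proj K)
  \<comment> \<open>The part of \<open>y\<close> orthogonal to \<open>ker B\<close> lies in
    \<open>range B\<close>, because the range is closed. A preimage \<open>?w\<close> of it without
    kernel component is mapped there by \<open>T\<close>, while \<open>T\<close> fixes the kernel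
    part \<open>?p\<close>.\<close>
  have "\<exists>x. T x = y" for y
  proof -
    have y: "y - orth_proj (ker B) y \<in> range B"
      using orth_proj_diff[OF K, of y] corth_corth[OF R cl] ker by metis
    then obtain u where u: "B u = y - orth_proj (ker B) y" by (metis rangeE)
    let ?w = "u - orth_proj (ker B) u" and ?p = "orth_proj (ker B) y"
    have k: "B (orth_proj (ker B) z) = 0" for z
      using orth_proj_in[OF K, of z] by (simp add: ker_def)
    have "orth_proj (ker B) (?w + ?p) = ?p"
      using orth_proj_diff[OF K, of u] orth_proj_eq_0_iff[OF K, of ?w]
      by (simp add: orth_proj_add[OF K] orth_proj_id[OF K orth_proj_in[OF K]])
    then have "T (?w + ?p) = y"
      by (simp add: T_def bounded_clinearD[OF B] k u)
    then show ?thesis by blast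
  qed
  then have "surj T" by (metis surjI)
  from open_mapping_bound[OF T this] obtain M
    where M: "\<And>y. \<exists>x. T x = y \<and> norm x \<le> M * norm y" by blast
  have "norm y \<le> M * norm (B y)" if y: "y \<in> corth (ker B)" for y
  proof -
    obtain x where x: "T x = B y" "norm x \<le> M * norm (B y)" using M by blast
    \<comment> \<open>This vector lies in both \<open>ker B\<close> and \<open>range B\<close>,
      which are orthogonal, so it is 0. Then \<open>y - x\<close> lies both in \<open>ker B\<close>
      and in its complement.\<close>
    have "orth_proj (ker B) x = B (y - x)"
      using x(1) by (simp add: T_def bounded_clinearD[OF B] algebra_simps)
    then have "orth_proj (ker B) x = 0"
      using corth_disjoint[of "B (y - x)" "range B"] orth_proj_in[OF K, of x] ker by auto
    moreover from this have "y - x \<in> ker B"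
      using \<open>orth_proj (ker B) x = B (y - x)\<close> by (simp add: ker_def)
    moreover have "y - x \<in> corth (ker B)"
      using y \<open>orth_proj (ker B) x = 0\<close> orth_proj_eq_0_iff[OF K] csubspace_diff[OF csubspace_corth]
      by blast
    ultimately have "y = x" using corth_disjoint[of "y - x" "ker B"] by simp
    with x(2) show ?thesis by simp
  qed
  then show ?thesis by (rule that)
qed

text \<open>A projection vanishes exactly on the complement of its range. For bounded linear
  \<open>B\<close> the double complement is the closure of \<open>range B\<close>.\<close>

lemma NPA_eq:
  fixes A B :: "'a::chilbert_space \<Rightarrow> 'a"
  shows "NPA A B = A -` corth (corth (range B))"
  unfolding NPA_def ker_def
  by (auto simp: orth_proj_eq_0_iff[OF csubspace_corth closed_corth])

context
  fixes A B :: "'a::chilbert_space \<Rightarrow> 'a"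
  assumes A: "bounded_clinear A" and B: "bounded_clinear B"
begin

lemma csubspace_NPA: "csubspace (NPA A B)" and closed_NPA: "closed (NPA A B)"
  unfolding NPA_eq
  by (simp_all add: A csubspace_vimage csubspace_corth closed_vimage_clinear closed_corth)

lemma ker_subset_NPA: "ker A \<subseteq> NPA A B"
  unfolding NPA_eq using csubspace_0[OF csubspace_corth] by (auto simp: ker_def)

text \<open>Since \<open>ker A\<close> is contained in \<open>NPA A B\<close>, splitting off the
  \<open>ker A\<close> component of a vector of \<open>NPA A B\<close> leaves a remainder in
  \<open>NPA A B\<close>, that is, in \<open>X2 A B\<close>.\<close>

lemma X12_eq_NPA: "X12 A B = NPA A B"
proof -
  have "x \<in> X12 A B" if x: "x \<in> NPA A B" for x
  proof -
    let ?p = "orth_proj (ker A) x"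
    have p: "?p \<in> ker A" "x - ?p \<in> corth (ker A)"
      using orth_proj_in orth_proj_diff csubspace_ker[OF A] closed_ker[OF A] by blast+
    moreover have "x - ?p \<in> NPA A B"
      using p x ker_subset_NPA csubspace_diff[OF csubspace_NPA] by blast
    moreover have "x = ?p + (x - ?p)" by simp
    ultimately show ?thesis
      unfolding X12_def subspace_sum_def X1_def X2_def ominus_def
        corth_corth[OF csubspace_NPA closed_NPA] by blast
  qed
  moreover have "X12 A B \<subseteq> NPA A B"
    unfolding X12_def subspace_sum_def X1_def X2_def ominus_def
      corth_corth[OF csubspace_NPA closed_NPA]
    using ker_subset_NPA csubspace_add[OF csubspace_NPA] by blast
  ultimately show ?thesis by blast
qed

end

context
  fixes A B :: "'a::chilbert_space \<Rightarrow> 'a"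
  assumes A: "bounded_clinear A" and B: "bounded_clinear B"
begin

lemma Y2_eq: "Y2 A B = corth (ker B) \<inter> NPA B A"
  by (simp add: Y2_def ominus_def corth_corth[OF csubspace_NPA[OF B A] closed_NPA[OF B A]])

text \<open>Vectors of \<open>Y2 A B\<close> are orthogonal to \<open>ker B\<close>, so
  \<open>B\<close> is injective there.\<close>

lemma B2_inv_eqI:
  assumes y: "y \<in> Y2 A B"
  shows "B2_inv A B (B y) = y"
proof -
  have "inj_on (B2 A B) (Y2 A B)"
  proof (rule inj_onI)
    fix u v assume u: "u \<in> Y2 A B" and v: "v \<in> Y2 A B" and eq: "B2 A B u = B2 A B v"
    have "u - v \<in> ker B" using u v eq by (simp add: B2_def ker_def bounded_clinearD[OF B])
    moreover have "u - v \<in> corth (ker B)"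
      using u v unfolding Y2_eq by (blast intro: csubspace_diff[OF csubspace_corth])
    ultimately show "u = v" using corth_disjoint[of "u - v" "ker B"] by simp
  qed
  from inv_into_f_f[OF this y] show ?thesis using y by (simp add: B2_inv_def B2_def)
qed

end

text \<open>The right-hand side does not depend on the choice of \<open>y\<close>: two choices differ by an element of
  \<open>ker B\<close>, which \<open>cadjoint A\<close> maps into the orthogonal complement of \<open>NPA A B\<close>. The choice in
  \<open>Y2 A B\<close> is the one made by \<open>B2_inv\<close>, up to sign.\<close>

lemma schur_op_eq:
  fixes A B C :: "'a::chilbert_space \<Rightarrow> 'a"
  assumes A: "bounded_clinear A" and B: "bounded_clinear B"
    and kerB: "ker B = corth (range B)"
    and xy: "(x, y) \<in> ker (row_op A B)"
  shows "schur_op A B C x = orth_proj (NPA A B) (C x - cadjoint A y)"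
proof -
  note N = csubspace_NPA[OF A B] closed_NPA[OF A B]
  note K = csubspace_ker[OF B] closed_ker[OF B]
  note P = bounded_clinearD[OF bounded_clinear_orth_proj[OF N]]
  note A' = bounded_clinearD[OF bounded_clinear_cadjoint[OF A]]
  have eq: "A x + B y = 0" using xy by (simp add: ker_def row_op_def)
  then have Ax: "A x = B (- y)" by (simp add: bounded_clinearD[OF B] eq_neg_iff_add_eq_0)
  \<comment> \<open>Removing the kernel part of \<open>y\<close> and changing sign gives
    \<open>n - y\<close>, the element of \<open>Y2 A B\<close> that \<open>B\<close> maps to
    \<open>A x\<close>.\<close>
  define n where "n = orth_proj (ker B) y"
  have n: "n \<in> ker B" "y - n \<in> corth (ker B)"
    unfolding n_def using orth_proj_in[OF K] orth_proj_diff[OF K] by blast+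
  have Bn: "B n = 0" using n by (simp add: ker_def)
  have xN: "x \<in> NPA A B"
    unfolding NPA_eq using Ax subset_corth_corth[of "range B"] by auto
  have "B (n - y) = A x" using Bn Ax by (simp add: bounded_clinearD[OF B])
  then have "n - y \<in> NPA B A"
    unfolding NPA_eq using subset_corth_corth[of "range A"] by auto
  moreover have "n - y \<in> corth (ker B)" using csubspace_neg[OF csubspace_corth n(2)] by simp
  ultimately have Y: "n - y \<in> Y2 A B" by (simp add: Y2_eq[OF A B])
  have "B2_inv A B (A x) = n - y"
    using B2_inv_eqI[OF A B Y] \<open>B (n - y) = A x\<close> by simp
  then have "schur_op A B C x = orth_proj (NPA A B) (C x) + orth_proj (NPA A B) (cadjoint A (n - y))"
    using xN Y by (simp add: schur_op_def C2_def minus_adj_A2_def A2_tilde_def X12_eq_NPA[OF A B])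
  also have "\<dots> = orth_proj (NPA A B) (C x - cadjoint A y) + orth_proj (NPA A B) (cadjoint A n)"
    by (simp add: P A')
  \<comment> \<open>For \<open>u\<close> in \<open>NPA A B\<close>, \<open>A u\<close> lies in the
    double complement of \<open>range B\<close>, whereas \<open>n\<close> lies in the complement of
    \<open>range B\<close>.\<close>
  also have "cadjoint A n \<in> corth (NPA A B)"
  proof -
    have "inner (cadjoint A n) u = 0" if "u \<in> NPA A B" for u
      using that n(1) inner_corth[of "A u" "corth (range B)" n]
      by (simp add: NPA_eq kerB inner_commute[of _ u] flip: inner_cadjoint[OF A])
    then show ?thesis by (simp add: corth_eq_inner[OF N(1)])
  qed
  then have "orth_proj (NPA A B) (cadjoint A n) = 0"
    by (simp add: orth_proj_eq_0_iff[OF N])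
  finally show ?thesis by simp
qed

text \<open>For \<open>n\<close> in \<open>ker B\<close>, write \<open>n = A s + B t\<close> with
  the right inverse. Pairing with \<open>n\<close> kills \<open>B t\<close>, so the squared norm of
  \<open>n\<close> is \<open>inner s (cadjoint A n)\<close> and \<open>cadjoint A\<close> is bounded
  below. This gives injectivity and a closed image, which therefore equals its double
  complement.\<close>

lemma cadjoint_ker_image:
  fixes A B :: "'a::chilbert_space \<Rightarrow> 'a"
  assumes A: "bounded_clinear A" and B: "bounded_clinear B"
    and BB: "\<And>x y. inner (B x) y = inner x (B y)" and kerB: "ker B = corth (range B)"
    and ri: "right_invertible (row_op A B)"
  shows "inj_on (cadjoint A) (ker B)" and "cadjoint A ` ker B = corth (NPA A B)"
proof -
  have A': "bounded_clinear (cadjoint A)" by (rule bounded_clinear_cadjoint[OF A])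
  obtain S where S: "bounded_clinear S" "\<And>z. row_op A B (S z) = z"
    using ri unfolding right_invertible_def by (metis comp_apply id_apply)
  obtain M where M: "M > 0" "\<And>z. norm (S z) \<le> norm z * M"
    using bounded_linear.pos_bounded[OF bounded_clinearD(1)[OF S(1)]] by blast
  have low: "norm n \<le> M * norm (cadjoint A n)" if n: "n \<in> ker B" for n
  proof (cases "n = 0")
    case False
    obtain s t where st: "S n = (s, t)" by fastforce
    then have "n = A s + B t" using S(2)[of n] by (simp add: row_op_def)
    then have "inner n n = inner (A s) n + inner (B t) n" by (metis inner_add_left)
    also have "\<dots> = inner s (cadjoint A n)"
      using n by (simp add: inner_cadjoint[OF A] BB ker_def)
    also have "\<dots> \<le> norm s * norm (cadjoint A n)" by (rule norm_cauchy_schwarz)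
    also have "\<dots> \<le> (norm n * M) * norm (cadjoint A n)"
      using M(2)[of n] norm_fst_le[of s t] st by (intro mult_right_mono) auto
    finally have "norm n * norm n \<le> norm n * (M * norm (cadjoint A n))"
      by (simp add: mult_ac flip: power2_eq_square power2_norm_eq_inner)
    then show ?thesis using False by simp
  qed (simp add: bounded_clinearD[OF A'])
  show "inj_on (cadjoint A) (ker B)"
  proof (rule inj_onI)
    fix u v assume "u \<in> ker B" "v \<in> ker B" "cadjoint A u = cadjoint A v"
    then show "u = v"
      using low[of "u - v"] csubspace_diff[OF csubspace_ker[OF B]]
      by (simp add: bounded_clinearD[OF A'])
  qed
  let ?W = "cadjoint A ` ker B"
  have sub: "csubspace ?W"
    by (rule csubspace_image[OF A' csubspace_ker[OF B]])
  have "complete ?W"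
  proof (rule complete_isometric_image)
    show "0 < inverse M" using M by simp
    show "bounded_linear (cadjoint A)" by (rule bounded_clinearD(1)[OF A'])
    show "subspace (ker B)" by (rule csubspace_imp_subspace[OF csubspace_ker[OF B]])
    show "\<forall>x\<in>ker B. inverse M * norm x \<le> norm (cadjoint A x)"
      using low M(1) by (simp add: field_simps)
    show "complete (ker B)" using closed_ker[OF B] by (simp add: complete_eq_closed)
  qed
  then have cl: "closed ?W" by (simp add: complete_eq_closed)
  \<comment> \<open>Moving \<open>A\<close> across the inner product, \<open>u\<close> is orthogonal
    to \<open>?W\<close> iff \<open>A u\<close> is orthogonal to \<open>ker B\<close>, the
    complement of \<open>range B\<close>.\<close>
  have "corth ?W = NPA A B"
    unfolding NPA_eq kerB[symmetric] vimage_def corth_eq_inner[OF sub]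
      corth_eq_inner[OF csubspace_ker[OF B]]
    by (simp add: inner_cadjoint[OF A])
  then show "?W = corth (NPA A B)" using corth_corth[OF sub cl] by simp
qed

lemma selfadjoint_ker_eq:
  fixes B :: "'a::chilbert_space \<Rightarrow> 'a"
  assumes B: "bounded_clinear B" and "B = cadjoint B"
  shows "ker B = corth (range B)"
proof -
  have "inner x (B y) = inner (B x) y" for x y
    using inner_cadjoint[OF B, of x y] assms(2) by simp
  then show ?thesis
    unfolding corth_eq_inner[OF csubspace_image[OF B csubspace_UNIV]] ker_def
    \<comment> \<open>The test vector \<open>B x\<close> gives
      \<open>inner (B x) (B x) = 0\<close>.\<close>
    by (auto dest: spec[of _ "B _"])
qed

theorem theorem4p1:
  fixes A B C :: "'a::chilbert_space \<Rightarrow> 'a"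
  assumes "separable_space (euclidean :: 'a topology)"
    and "bounded_clinear A" and "bounded_clinear B" and "bounded_clinear C"
    and "right_invertible (row_op A B)"
    and "B = cadjoint B" and "C = cadjoint C"
  shows "(cisomorphism_on UNIV UNIV (hamiltonian A B C) \<longleftrightarrow>
           bij_betw (schur_op A B C) (fst ` ker (row_op A B)) (NPA A B)) \<and>
         (cisomorphism_on UNIV UNIV (hamiltonian A B C) \<and> closed (range B) \<longrightarrow>
           cisomorphism_on (NPA A B) (NPA A B) (schur_op A B C))"
proof -
  note A = assms(2) and B = assms(3) and C = assms(4)
  let ?N = "NPA A B" and ?K = "ker (row_op A B)" and ?S = "schur_op A B C"
  let ?H = "hamiltonian A B C" and ?A' = "cadjoint A" and ?P = "orth_proj (NPA A B)"
  note N = csubspace_NPA[OF A B] closed_NPA[OF A B]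
  note A' = bounded_clinear_cadjoint[OF A]
  note P = bounded_clinear_orth_proj[OF N]
  note H = bounded_clinear_hamiltonian[OF A B C]
  note R = bounded_clinear_row_op[OF A B]
  note lin = bounded_clinearD[OF A] bounded_clinearD[OF B] bounded_clinearD[OF C]
    bounded_clinearD[OF A'] bounded_clinearD[OF P]
  have kerB: "ker B = corth (range B)" using selfadjoint_ker_eq[OF B] assms(6) by blast
  have BB: "inner (B x) y = inner x (B y)" for x y
    using inner_cadjoint[OF B, of x y] assms(6) by simp
  note A'_ker = cadjoint_ker_image[OF A B BB kerB assms(5)]
  note S_eq = schur_op_eq[OF A B kerB, where C=C]
  have H_eq: "?H (x, y) = (A x + B y, C x - ?A' y)" for x y
    by (simp add: hamiltonian_def block_op_def row_op_def)
  have K_iff: "(x, y) \<in> ?K \<longleftrightarrow> A x + B y = 0" for x y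
    by (simp add: ker_def row_op_def)
  have S_in: "?S x \<in> ?N" if "x \<in> fst ` ?K" for x
    using that S_eq orth_proj_in[OF N] by force
  have surjR: "\<exists>x y. A x + B y = z" for z
    using assms(5) unfolding right_invertible_def row_op_def
    by (metis comp_apply id_apply case_prod_unfold)
  \<comment> \<open>Whatever the projection onto \<open>?N\<close> does not see can be corrected by
    changing \<open>y\<close> within \<open>ker B\<close>, which leaves \<open>A x + B y\<close>
    unchanged.\<close>
  have solve: "\<exists>n. B n = 0 \<and> ?A' n = z" if "?P z = 0" for z
    using that A'_ker(2) orth_proj_eq_0_iff[OF N, of z] by (force simp: ker_def)

  have bij_if: "bij ?H" if S: "bij_betw ?S (fst ` ?K) ?N"
  proof (rule bijI)
    show "inj ?H"
    proof (rule linear_injective_0[THEN iffD2, rule_format])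
      show "linear ?H" using bounded_clinearD(1)[OF H] by (rule bounded_linear.linear)
      fix p assume p: "?H p = 0"
      obtain x y where xy: "p = (x, y)" by fastforce
      then have K: "(x, y) \<in> ?K" and C0: "C x - ?A' y = 0"
        using p by (auto simp: H_eq K_iff zero_prod_def)
      \<comment> \<open>Linearity of \<open>?S\<close> is not yet established, so \<open>x\<close>
        is compared with 0 through injectivity, and \<open>S_eq\<close> evaluates \<open>?S\<close>
        at both points.\<close>
      have K0: "(0, 0) \<in> ?K" by (simp add: K_iff lin)
      have "?S x = ?S 0" using S_eq[OF K] S_eq[OF K0] C0 by (simp add: lin)
      moreover have "x \<in> fst ` ?K" "0 \<in> fst ` ?K" using K K0 by (metis fst_conv imageI)+
      ultimately have "x = 0" by (rule inj_onD[OF bij_betw_imp_inj_on[OF S]])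
      then have "y \<in> ker B" "?A' y = ?A' 0"
        using K[unfolded K_iff] C0 by (simp_all add: lin ker_def)
      then have "y = 0" using A'_ker(1) csubspace_0[OF csubspace_ker[OF B]] by (auto simp: inj_on_def)
      then show "p = 0" using xy \<open>x = 0\<close> by (simp add: zero_prod_def)
    qed
    have "\<exists>p. ?H p = (u, v)" for u v
    proof -
      obtain x0 y0 where u: "A x0 + B y0 = u" using surjR by blast
      \<comment> \<open>\<open>w\<close> is the error in the second component once
        \<open>(x0, y0)\<close> has matched the first. An element of \<open>?K\<close> removes its
        projection onto \<open>?N\<close>, and some \<open>n\<close> in \<open>ker B\<close> removes
        the rest.\<close>
      define w where "w = v - (C x0 - ?A' y0)"
      have "?P w \<in> ?S ` (fst ` ?K)"
        using S orth_proj_in[OF N] by (auto simp: bij_betw_def)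
      then obtain x y where K: "(x, y) \<in> ?K" and "?P w = ?S x" by auto
      then have "?P (w - (C x - ?A' y)) = 0" using S_eq[OF K] by (simp add: lin)
      then obtain n where "B n = 0" "?A' n = w - (C x - ?A' y)" using solve by blast
      then have "?H (x0 + x, y0 + (y - n)) = (u, v)"
        using u K by (simp add: H_eq K_iff lin w_def algebra_simps)
      then show ?thesis by blast
    qed
    then show "surj ?H" unfolding surj_def by (metis surj_pair)
  qed

  have S_if: "bij_betw ?S (fst ` ?K) ?N" if b: "bij ?H"
    unfolding bij_betw_def
  proof (intro conjI inj_onI equalityI subsetI)
    fix x x' assume "x \<in> fst ` ?K" "x' \<in> fst ` ?K" and eq: "?S x = ?S x'"
    then obtain y y' where K: "(x, y) \<in> ?K" "(x', y') \<in> ?K" by auto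
    have "?P ((C x - ?A' y) - (C x' - ?A' y')) = 0"
      using eq S_eq[OF K(1)] S_eq[OF K(2)] by (simp add: lin)
    \<comment> \<open>Adding \<open>n\<close> to \<open>y\<close> keeps the first component of
      \<open>?H\<close> and makes the second components agree.\<close>
    then obtain n where "B n = 0" "?A' n = (C x - ?A' y) - (C x' - ?A' y')" using solve by blast
    then have "?H (x, y + n) = ?H (x', y')"
      using K by (simp add: H_eq K_iff lin algebra_simps)
    then show "x = x'" using b by (auto simp: bij_def inj_def)
  next
    fix z assume z: "z \<in> ?N"
    obtain x y where xy: "?H (x, y) = (0, z)" using b by (metis bij_pointE surj_pair)
    then have K: "(x, y) \<in> ?K" and "C x - ?A' y = z" by (auto simp: H_eq K_iff)
    then have "?S x = z" using S_eq[OF K] orth_proj_id[OF N z] by simp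
    then show "z \<in> ?S ` (fst ` ?K)" using K by force
  qed (use S_in in blast)

  have iso: "cisomorphism_on ?N ?N ?S" if iH: "cisomorphism_on UNIV UNIV ?H" and cl: "closed (range B)"
  proof -
    have b: "bij ?H" using iH by (simp add: cisomorphism_on_def)
    obtain M where M: "\<And>y. y \<in> corth (ker B) \<Longrightarrow> norm y \<le> M * norm (B y)"
      using closed_range_bounded_below[OF B kerB cl] by blast
    \<comment> \<open>Closedness of the range puts \<open>A x\<close> in \<open>range B\<close>. The
      partner \<open>y\<close> is a preimage of \<open>- A x\<close> orthogonal to
      \<open>ker B\<close>, where \<open>M\<close> bounds its norm.\<close>
    have ex: "\<exists>y. (x, y) \<in> ?K \<and> norm y \<le> M * norm (A x)" if "x \<in> ?N" for x
    proof -
      have "A x \<in> range B"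
        using that unfolding NPA_eq corth_corth[OF csubspace_image[OF B csubspace_UNIV] cl] by simp
      then obtain u where u: "A x = B u" by blast
      let ?q = "orth_proj (ker B) u"
      have q: "?q \<in> ker B" "u - ?q \<in> corth (ker B)"
        using orth_proj_in orth_proj_diff csubspace_ker[OF B] closed_ker[OF B] by blast+
      then have "B (u - ?q) = A x" using u by (simp add: lin ker_def)
      then have "(x, - (u - ?q)) \<in> ?K" "norm (- (u - ?q)) \<le> M * norm (A x)"
        using M[OF q(2)] by (simp_all add: K_iff bounded_clinearD(5)[OF B] del: minus_diff_eq)
      then show ?thesis by blast
    qed
    have dom: "fst ` ?K = ?N"
    proof
      show "fst ` ?K \<subseteq> ?N"
      proof
        fix x assume "x \<in> fst ` ?K"
        then obtain y where "A x + B y = 0" by (auto simp: K_iff)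
        then have "A x = B (- y)" by (simp add: lin eq_neg_iff_add_eq_0)
        then show "x \<in> ?N" unfolding NPA_eq using subset_corth_corth[of "range B"] by auto
      qed
    qed (use ex in force)
    have Sbij: "bij_betw ?S ?N ?N" using S_if[OF b] dom by simp
    have Kadd: "(x + x', y + y') \<in> ?K" if "(x, y) \<in> ?K" "(x', y') \<in> ?K" for x y x' y'
      using csubspace_add[OF csubspace_ker[OF R] that] by simp
    have Kscale: "(c *\<^sub>C x, c *\<^sub>C y) \<in> ?K" if "(x, y) \<in> ?K" for c x y
      using csubspace_scaleC[OF csubspace_ker[OF R] that] by (simp add: scaleC_prod_def)
    \<comment> \<open>By \<open>S_eq\<close> any partner of \<open>x + x'\<close> may be used, in
      particular the sum of the partners of \<open>x\<close> and \<open>x'\<close>.\<close>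
    have add: "?S (x + x') = ?S x + ?S x'" if x: "x \<in> ?N" "x' \<in> ?N" for x x'
    proof -
      obtain y y' where K: "(x, y) \<in> ?K" "(x', y') \<in> ?K" using x ex by blast
      show ?thesis using S_eq[OF Kadd[OF K]] S_eq[OF K(1)] S_eq[OF K(2)] by (simp add: lin)
    qed
    have scale: "?S (c *\<^sub>C x) = c *\<^sub>C ?S x" if x: "x \<in> ?N" for c x
    proof -
      obtain y where K: "(x, y) \<in> ?K" using x ex by blast
      have "C (c *\<^sub>C x) - ?A' (c *\<^sub>C y) = c *\<^sub>C (C x - ?A' y)"
        by (simp add: bounded_clinearD(2)[OF C] bounded_clinearD(2)[OF A'] scaleC_add_right
            scaleC_minus_right flip: add_uminus_conv_diff)
      then show ?thesis using S_eq[OF Kscale[OF K]] S_eq[OF K] bounded_clinearD(2)[OF P] by simp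
    qed
    obtain a where a: "\<And>x. norm (A x) \<le> norm x * a"
      using bounded_linear.bounded[OF bounded_clinearD(1)[OF A]] by blast
    obtain a' where a': "a' \<ge> 0" "\<And>x. norm (?A' x) \<le> norm x * a'"
      using bounded_linear.nonneg_bounded[OF bounded_clinearD(1)[OF A']] by blast
    obtain c where c: "\<And>x. norm (C x) \<le> norm x * c"
      using bounded_linear.bounded[OF bounded_clinearD(1)[OF C]] by blast
    have bound: "norm (?S x) \<le> (c + \<bar>M\<bar> * a * a') * norm x" if x: "x \<in> ?N" for x
    proof -
      obtain y where K: "(x, y) \<in> ?K" and y: "norm y \<le> M * norm (A x)" using x ex by blast
      \<comment> \<open>The absolute value is taken because the sign of \<open>M\<close> is
        unknown.\<close>
      have "M * norm (A x) \<le> \<bar>M\<bar> * (norm x * a)"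
        by (intro mult_mono a) auto
      with y have y': "norm y \<le> \<bar>M\<bar> * (norm x * a)" by simp
      have "norm (?S x) \<le> norm (C x - ?A' y)"
        using S_eq[OF K] norm_orth_proj_le[OF N] by simp
      also have "\<dots> \<le> norm (C x) + norm (?A' y)" by (rule norm_triangle_ineq4)
      also have "\<dots> \<le> norm x * c + (\<bar>M\<bar> * (norm x * a)) * a'"
        using a'(2)[of y] mult_right_mono[OF y' a'(1)] c[of x] by linarith
      finally show ?thesis by (simp add: algebra_simps)
    qed
    have S_bdd: "bounded_clinear_on ?N ?N ?S"
      unfolding bounded_clinear_on_def using bij_betw_imp_surj_on[OF Sbij] add scale bound by blast
    let ?T = "inv_into ?N ?S"
    have T: "?T z \<in> ?N" "?S (?T z) = z" if "z \<in> ?N" for z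
      using that Sbij by (auto simp: bij_betw_def inv_into_into f_inv_into_f)
    have Teq: "?T z = x" if "x \<in> ?N" "?S x = z" for x z
      using that Sbij by (auto simp: bij_betw_def inv_into_f_f)
    have iHb: "bounded_clinear (inv ?H)" using iH by (simp add: cisomorphism_on_def)
    obtain h where h: "\<And>p. norm (inv ?H p) \<le> norm p * h"
      using bounded_linear.bounded[OF bounded_clinearD(1)[OF iHb]] by blast
    \<comment> \<open>The preimage of \<open>z\<close> under \<open>?S\<close> is the first
      component of the preimage of \<open>(0, z)\<close> under \<open>?H\<close>, so it inherits the
      bound \<open>h\<close>.\<close>
    have Tbound: "norm (?T z) \<le> h * norm z" if z: "z \<in> ?N" for z
    proof -
      obtain x y where xy: "inv ?H (0, z) = (x, y)" by fastforce
      then have "?H (x, y) = (0, z)" using b by (metis bij_inv_eq_iff)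
      then have K: "(x, y) \<in> ?K" and "C x - ?A' y = z" by (auto simp: H_eq K_iff)
      then have "?S x = z" using S_eq[OF K] orth_proj_id[OF N z] by simp
      moreover have "x \<in> ?N" using K dom by force
      ultimately have "?T z = x" by (intro Teq)
      then show ?thesis using h[of "(0, z)"] xy norm_fst_le[of x y] by (simp add: mult.commute)
    qed
    have "bounded_clinear_on ?N ?N ?T"
      unfolding bounded_clinear_on_def
    proof (intro conjI ballI allI)
      show "?T ` ?N \<subseteq> ?N" using T by blast
      show "?T (z + z') = ?T z + ?T z'" if "z \<in> ?N" "z' \<in> ?N" for z z'
        using that T by (intro Teq) (simp_all add: add csubspace_add[OF N(1)])
      show "?T (c *\<^sub>C z) = c *\<^sub>C ?T z" if "z \<in> ?N" for c z
        using that T by (intro Teq) (simp_all add: scale csubspace_scaleC[OF N(1)])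
      show "\<exists>k. \<forall>z\<in>?N. norm (?T z) \<le> k * norm z" using Tbound by blast
    qed
    with S_bdd Sbij show ?thesis by (simp add: cisomorphism_on_def)
  qed
  show ?thesis using bij_if S_if iso cisomorphism_on_UNIV_iff[OF H] by blast
qed

end
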